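(* Let $(P,\preceq)$ be a locally finite lattice and $f:P\to\mathbb{C}$. Let $X=\{x_1,\dots,x_n\}$ and $Y=\{y_1,\dots,y_n\}$ be subsets of $P$, indexed so that $x_i\preceq x_j\Rightarrow i\le j$ and $y_i\preceq y_j\Rightarrow i\le j$. Let $D=\{d_1,\dots,d_m\}$ be any finite subset of $P$ containing all $x_i\vee y_j$, indexed so that $d_i\preceq d_j\Rightarrow i\le j$. Let $X_i=X\setminus\{x_i\}$ and $Y_i=Y\setminus\{y_i\}$. If $[X,Y]_f$ is invertible, then its inverse is the $n\times n$ matrix $B=(b_{ij})$ with $$b_{ij}=\frac{(-1)^{i+j}}{\det[X,Y]_f}\sum_{1\le k_1<\cdots<k_{n-1}\le m}\det E(X_j)_{(k_1,\dots,k_{n-1})}\det E(Y_i)_{(k_1,\dots,k_{n-1})}\,\Psi_{D,f}(d_{k_1})\cdots\Psi_{D,f}(d_{k_{n-1}}).$$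
   Context: $[X,Y]_f$ is the $n\times n$ matrix with $(i,j)$ entry $f(x_i\vee y_j)$. $\Psi_{D,f}$ is defined on $D$ recursively by $\Psi_{D,f}(d_k)=f(d_k)-\sum_{d_v\in D,\ d_k\prec d_v}\Psi_{D,f}(d_v)$. For a subset $Z=\{z_1,\dots,z_r\}$ of $P$ (listed in its induced order), $E(Z)$ is the $r\times m$ matrix with $(i,j)$ entry $1$ if $z_i\preceq d_j$ and $0$ otherwise; thus $E(X_j)$ is $E(X)$ with row $j$ deleted and $E(Y_i)$ is $E(Y)$ with row $i$ deleted. For an $r\times m$ matrix $A$ and $1\le k_1<\dots<k_r\le m$, $A_{(k_1,\dots,k_r)}$ is the $r\times r$ submatrix of $A$ consisting of columns $k_1,\dots,k_r$. *)

theory Defs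
  imports Complex_Main "Jordan_Normal_Form.Determinant"
begin

text \<open>
  A finite subset \<open>{z\<^sub>1, \<dots>, z\<^sub>r}\<close> together with its indexing is represented by the list of its
  elements. Lists and matrices are indexed from 0; the parity of \<open>i + j\<close> does not depend on
  whether both indices start at 0 or at 1.
\<close>

definition order_indexed :: "'a::order list \<Rightarrow> bool" where
  "order_indexed zs \<longleftrightarrow> distinct zs \<and>
     (\<forall>i<length zs. \<forall>j<length zs. zs ! i \<le> zs ! j \<longrightarrow> i \<le> j)"

definition join_mat :: "('a::lattice \<Rightarrow> complex) \<Rightarrow> 'a list \<Rightarrow> 'a list \<Rightarrow> complex mat" where
  "join_mat f xs ys = mat (length xs) (length ys) (\<lambda>(i, j). f (sup (xs ! i) (ys ! j)))"

text \<open>The guard \<open>finite D\<close> only serves to make the recursion well-founded.\<close>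

function Psi :: "'a::order set \<Rightarrow> ('a \<Rightarrow> complex) \<Rightarrow> 'a \<Rightarrow> complex" where
  "Psi D f d = (if finite D then f d - (\<Sum>v\<in>{v \<in> D. d < v}. Psi D f v) else 0)"
  by pat_completeness auto
termination
proof (relation "measure (\<lambda>(D, f, d). card {v \<in> D. d < v})")
  fix D :: "'a set" and f :: "'a \<Rightarrow> complex" and d v
  assume fin: "finite D" and v: "v \<in> {v \<in> D. d < v}"
  have "{w \<in> D. v < w} \<subset> {w \<in> D. d < w}"
    using v by (auto intro: less_trans)
  then have "card {w \<in> D. v < w} < card {w \<in> D. d < w}"
    using fin by (intro psubset_card_mono) auto
  then show "((D, f, v), (D, f, d)) \<in> measure (\<lambda>(D, f, d). card {v \<in> D. d < v})"
    by simp
qed simp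

declare Psi.simps [simp del]

definition incidence_mat :: "'a::order list \<Rightarrow> 'a list \<Rightarrow> complex mat" where
  "incidence_mat ds zs =
     mat (length zs) (length ds) (\<lambda>(i, j). if zs ! i \<le> ds ! j then 1 else 0)"

definition select_cols :: "'b mat \<Rightarrow> nat list \<Rightarrow> 'b mat" where
  "select_cols A ks = mat (dim_row A) (length ks) (\<lambda>(i, j). A $$ (i, ks ! j))"

definition increasing_tuples :: "nat \<Rightarrow> nat \<Rightarrow> nat list set" where
  "increasing_tuples r m = {ks. length ks = r \<and> sorted_wrt (<) ks \<and> set ks \<subseteq> {..<m}}"

end

theory Submission
  imports Defs "HOL-Combinatorics.Multiset_Permutations"
begin

text \<open>
  Since \<open>D\<close> contains all joins, Moebius inversion gives \<open>f (x \<squnion> y)\<close> as the sum of \<open>\<Psi>\<^sub>D\<^sub>,\<^sub>f d\<close> over the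
  \<open>d \<in> D\<close> above both \<open>x\<close> and \<open>y\<close>, that is \<open>[X,Y]\<^sub>f = E(X) \<Lambda> E(Y)\<^sup>T\<close> with \<open>\<Lambda>\<close> the diagonal matrix of the
  \<open>\<Psi>\<close>-values. The minors of \<open>[X,Y]\<^sub>f\<close> are matrices of the same kind for the sets \<open>X\<^sub>j\<close> and \<open>Y\<^sub>i\<close>, so
  the Cauchy-Binet formula evaluates the cofactors, and Cramer's rule gives the inverse.
\<close>

section \<open>Lists of indices and increasing tuples\<close>

lemma bij_betw_permute_list:
  assumes "distinct xs"
  shows "bij_betw (\<lambda>p. permute_list p xs) {p. p permutes {..<length xs}}
    (permutations_of_set (set xs))"
proof (rule bij_betw_imageI)
  show "inj_on (\<lambda>p. permute_list p xs) {p. p permutes {..<length xs}}"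
  proof (rule inj_onI, clarify)
    fix p q
    assume p: "p permutes {..<length xs}" and q: "q permutes {..<length xs}"
      and eq: "permute_list p xs = permute_list q xs"
    show "p = q"
    proof
      fix i
      show "p i = q i"
      proof (cases "i < length xs")
        case True
        then have "xs ! p i = xs ! q i"
          using p q eq by (metis permute_list_nth)
        moreover have "p i < length xs" "q i < length xs"
          using True permutes_in_image[OF p] permutes_in_image[OF q] by auto
        ultimately show ?thesis
          using assms by (simp add: nth_eq_iff_index_eq)
      next
        case False
        then show ?thesis using p q by (simp add: permutes_not_in)
      qed
    qed
  qed
  show "(\<lambda>p. permute_list p xs) ` {p. p permutes {..<length xs}} = permutations_of_set (set xs)"
  proof (intro equalityI subsetI)
    fix ys assume "ys \<in> permutations_of_set (set xs)"
    then have "mset ys = mset xs"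
      using assms by (auto simp: permutations_of_set_def set_eq_iff_mset_eq_distinct[symmetric])
    then obtain p where "p permutes {..<length xs}" "permute_list p xs = ys"
      by (rule mset_eq_permutation)
    then show "ys \<in> (\<lambda>p. permute_list p xs) ` {p. p permutes {..<length xs}}" by blast
  qed (use assms in auto)
qed

(* Fixing the indices outside {0..<r} is the convention of det_linear_rows_sum. *)
lemma bij_betw_map_upt_lists:
  "bij_betw (\<lambda>g. map g [0..<r]) {g. (\<forall>i\<in>{0..<r}. g i \<in> S) \<and> (\<forall>i. i \<notin> {0..<r} \<longrightarrow> g i = i)}
    {xs. set xs \<subseteq> S \<and> length xs = r}"
  (is "bij_betw ?list ?F ?L")
proof (rule bij_betw_byWitness[where f' = "\<lambda>xs i. if i < r then xs ! i else i"])
  let ?fun = "\<lambda>xs i. if i < r then xs ! i else i"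
  show "\<forall>g\<in>?F. ?fun (?list g) = g" by (auto simp: fun_eq_iff)
  show "\<forall>xs\<in>?L. ?list (?fun xs) = xs" by (auto intro: nth_equalityI)
  show "?list ` ?F \<subseteq> ?L" by auto
  show "?fun ` ?L \<subseteq> ?F" by (auto simp: subset_iff)
qed

lemma increasing_tuples_eq_sorted_distinct:
  "increasing_tuples r m = {ks. set ks \<subseteq> {..<m} \<and> length ks = r \<and> sorted ks \<and> distinct ks}"
  by (auto simp: increasing_tuples_def strict_sorted_iff)

lemma finite_increasing_tuples: "finite (increasing_tuples r m)"
  by (rule finite_subset[OF _ finite_lists_length_eq[of "{..<m}" r]])
    (auto simp: increasing_tuples_def)

lemma sum_distinct_lists_eq_sum_increasing_tuples:
  "(\<Sum>js | set js \<subseteq> {..<m} \<and> length js = r \<and> distinct js. h js) =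
    (\<Sum>ks \<in> increasing_tuples r m. \<Sum>js \<in> permutations_of_set (set ks). h js)"
proof -
  let ?L = "{js. set js \<subseteq> {..<m} \<and> length js = r \<and> distinct js}"
  have fiber: "{js \<in> ?L. sort js = ks} = permutations_of_set (set ks)"
    if "ks \<in> increasing_tuples r m" for ks
  proof -
    from that have ks: "set ks \<subseteq> {..<m}" "length ks = r" "sorted ks" "distinct ks"
      by (simp_all add: increasing_tuples_eq_sorted_distinct)
    show ?thesis
    proof (intro equalityI subsetI)
      fix js assume "js \<in> permutations_of_set (set ks)"
      then have js: "set js = set ks" "distinct js"
        by (simp_all add: permutations_of_set_def)
      then have "length js = r"
        using ks by (metis distinct_card)
      moreover have "sort js = ks"
        using js ks by (intro sorted_distinct_set_unique) simp_all
      ultimately show "js \<in> {js \<in> ?L. sort js = ks}"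
        using js ks by simp
    qed (auto simp: permutations_of_set_def)
  qed
  have "finite ?L"
    by (rule finite_subset[OF _ finite_lists_length_eq[of "{..<m}" r]]) auto
  then have "(\<Sum>js\<in>?L. h js) =
      (\<Sum>ks \<in> increasing_tuples r m. \<Sum>js | js \<in> ?L \<and> sort js = ks. h js)"
    by (intro sum.group[symmetric] finite_increasing_tuples)
      (auto simp: increasing_tuples_eq_sorted_distinct)
  then show ?thesis using fiber by simp
qed

section \<open>The Cauchy-Binet formula\<close>

lemma select_cols_carrier [simp]:
  "A \<in> carrier_mat r m \<Longrightarrow> select_cols A ks \<in> carrier_mat r (length ks)"
  by (auto simp: select_cols_def)

lemma det_select_cols_not_distinct:
  fixes A :: "'a::comm_ring_1 mat"
  assumes "A \<in> carrier_mat (length js) m" and "\<not> distinct js"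
  shows "det (select_cols A js) = 0"
proof -
  obtain i j where "i < length js" "j < length js" "i \<noteq> j" "js ! i = js ! j"
    using assms(2) by (auto simp: distinct_conv_nth)
  moreover from this have "col (select_cols A js) i = col (select_cols A js) j"
    by (intro eq_vecI) (auto simp: select_cols_def)
  ultimately show ?thesis
    using assms(1) by (blast intro: det_identical_columns select_cols_carrier)
qed

lemma det_select_cols_permute_list:
  fixes A :: "'a::comm_ring_1 mat"
  assumes A: "A \<in> carrier_mat (length ks) m" and p: "p permutes {..<length ks}"
  shows "det (select_cols A (permute_list p ks)) = signof p * det (select_cols A ks)"
proof -
  let ?r = "length ks"
  have "(select_cols A (permute_list p ks))\<^sup>T =
      mat ?r ?r (\<lambda>(i, j). (select_cols A ks)\<^sup>T $$ (p i, j))"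
    using A permutes_in_image[OF p]
    by (intro eq_matI) (auto simp: select_cols_def permute_list_nth[OF p])
  moreover have "select_cols A (permute_list p ks) \<in> carrier_mat ?r ?r"
    using select_cols_carrier[OF A, of "permute_list p ks"] by simp
  ultimately show ?thesis
    using det_permute_rows[of "(select_cols A ks)\<^sup>T" ?r p] A p
    by (metis det_transpose lessThan_atLeast0 select_cols_carrier transpose_carrier_mat)
qed

lemma det_mult_transpose_eq_sum_lists:
  fixes A B :: "'a::comm_ring_1 mat"
  assumes A: "A \<in> carrier_mat r m" and B: "B \<in> carrier_mat r m"
  shows "det (A * B\<^sup>T) = (\<Sum>js | set js \<subseteq> {..<m} \<and> length js = r.
    (\<Prod>i<r. A $$ (i, js ! i)) * det (select_cols B js))"
proof -
  let ?F = "{g. (\<forall>i\<in>{0..<r}. g i \<in> {..<m}) \<and> (\<forall>i. i \<notin> {0..<r} \<longrightarrow> g i = i)}"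
  let ?h = "\<lambda>js. (\<Prod>i<r. A $$ (i, js ! i)) * det (select_cols B js)"
  have det_rows: "det (mat\<^sub>r r r (\<lambda>i. A $$ (i, g i) \<cdot>\<^sub>v row B\<^sup>T (g i))) = ?h (map g [0..<r])"
    if "g \<in> ?F" for g
  proof -
    have "mat\<^sub>r r r (\<lambda>i. row B\<^sup>T (g i)) = (select_cols B (map g [0..<r]))\<^sup>T"
      using B that by (intro eq_matI) (auto simp: select_cols_def)
    moreover have "select_cols B (map g [0..<r]) \<in> carrier_mat r r"
      using select_cols_carrier[OF B, of "map g [0..<r]"] by simp
    moreover have "(\<lambda>i. row B\<^sup>T (g i)) \<in> {0..<r} \<rightarrow> carrier_vec r"
      using B row_carrier[of "B\<^sup>T"] by (simp add: Pi_def)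
    moreover have "(\<Prod>i<r. A $$ (i, map g [0..<r] ! i)) = (\<Prod>i<r. A $$ (i, g i))"
      by (intro prod.cong) auto
    ultimately show ?thesis
      using det_rows_mul[of "\<lambda>i. row B\<^sup>T (g i)" r "\<lambda>i. A $$ (i, g i)"]
      by (simp only: det_transpose atLeast0LessThan)
  qed
  have rows: "A * B\<^sup>T =
      mat\<^sub>r r r (\<lambda>i. finsum_vec TYPE('a) r (\<lambda>k. A $$ (i, k) \<cdot>\<^sub>v row B\<^sup>T k) {..<m})"
    using mat_mul_finsum_alt[OF A, of "B\<^sup>T" r] B by (simp add: atLeast0LessThan)
  have "det (A * B\<^sup>T) = (\<Sum>g\<in>?F. det (mat\<^sub>r r r (\<lambda>i. A $$ (i, g i) \<cdot>\<^sub>v row B\<^sup>T (g i))))"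
    unfolding rows using B by (intro det_linear_rows_sum) auto
  also have "\<dots> = (\<Sum>g\<in>?F. ?h (map g [0..<r]))"
    by (rule sum.cong[OF refl]) (rule det_rows)
  also have "\<dots> = (\<Sum>js | set js \<subseteq> {..<m} \<and> length js = r. ?h js)"
    by (rule sum.reindex_bij_betw[OF bij_betw_map_upt_lists, where g = ?h])
  finally show ?thesis .
qed

lemma sum_permutations_prod_mult_det_select_cols:
  fixes A B :: "'a::comm_ring_1 mat"
  assumes A: "A \<in> carrier_mat (length ks) m" and B: "B \<in> carrier_mat (length ks) m"
    and "distinct ks"
  shows "(\<Sum>js \<in> permutations_of_set (set ks).
      (\<Prod>i<length ks. A $$ (i, js ! i)) * det (select_cols B js)) =
    det (select_cols A ks) * det (select_cols B ks)"
proof -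
  let ?r = "length ks"
  have "(\<Sum>js \<in> permutations_of_set (set ks).
        (\<Prod>i<?r. A $$ (i, js ! i)) * det (select_cols B js)) =
      (\<Sum>p | p permutes {..<?r}. (\<Prod>i<?r. A $$ (i, permute_list p ks ! i)) *
        det (select_cols B (permute_list p ks)))"
    by (rule sum.reindex_bij_betw[OF bij_betw_permute_list[OF assms(3)], symmetric])
  also have "\<dots> = (\<Sum>p | p permutes {..<?r}.
      signof p * (\<Prod>i<?r. select_cols A ks $$ (i, p i)) * det (select_cols B ks))"
  proof (rule sum.cong[OF refl], clarify)
    fix p assume p: "p permutes {..<?r}"
    have "(\<Prod>i<?r. A $$ (i, permute_list p ks ! i)) = (\<Prod>i<?r. select_cols A ks $$ (i, p i))"
      using A permutes_in_image[OF p]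
      by (intro prod.cong) (auto simp: select_cols_def permute_list_nth[OF p])
    then show "(\<Prod>i<?r. A $$ (i, permute_list p ks ! i)) *
          det (select_cols B (permute_list p ks)) =
        signof p * (\<Prod>i<?r. select_cols A ks $$ (i, p i)) * det (select_cols B ks)"
      by (simp add: det_select_cols_permute_list[OF B p] mult_ac)
  qed
  also have "\<dots> = det (select_cols A ks) * det (select_cols B ks)"
    using det_def'[OF select_cols_carrier[OF A]]
    by (simp add: sum_distrib_right atLeast0LessThan)
  finally show ?thesis .
qed

theorem Cauchy_Binet:
  fixes A B :: "'a::comm_ring_1 mat"
  assumes A: "A \<in> carrier_mat r m" and B: "B \<in> carrier_mat r m"
  shows "det (A * B\<^sup>T) =
    (\<Sum>ks \<in> increasing_tuples r m. det (select_cols A ks) * det (select_cols B ks))"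
proof -
  let ?h = "\<lambda>js. (\<Prod>i<r. A $$ (i, js ! i)) * det (select_cols B js)"
  have "det (A * B\<^sup>T) = (\<Sum>js | set js \<subseteq> {..<m} \<and> length js = r. ?h js)"
    by (rule det_mult_transpose_eq_sum_lists[OF A B])
  also have "\<dots> = (\<Sum>js | set js \<subseteq> {..<m} \<and> length js = r \<and> distinct js. ?h js)"
    using B det_select_cols_not_distinct[of B]
    by (intro sum.mono_neutral_right) (auto simp: finite_lists_length_eq)
  also have "\<dots> = (\<Sum>ks \<in> increasing_tuples r m. \<Sum>js \<in> permutations_of_set (set ks). ?h js)"
    by (rule sum_distinct_lists_eq_sum_increasing_tuples)
  also have "\<dots> = (\<Sum>ks \<in> increasing_tuples r m. det (select_cols A ks) * det (select_cols B ks))"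
    using A B sum_permutations_prod_mult_det_select_cols
    by (intro sum.cong refl) (auto simp: increasing_tuples_eq_sorted_distinct)
  finally show ?thesis .
qed

lemma det_mat_diag:
  fixes w :: "nat \<Rightarrow> 'a::comm_ring_1"
  shows "det (mat_diag n w) = (\<Prod>i<n. w i)"
proof -
  have "upper_triangular (mat_diag n w)" by (auto simp: mat_diag_def)
  then have "det (mat_diag n w) = prod_list (diag_mat (mat_diag n w))"
    by (rule det_upper_triangular[OF _ mat_diag_dim])
  also have "\<dots> = (\<Prod>i<n. w i)"
    by (simp add: prod_list_diag_prod mat_diag_def atLeast0LessThan)
  finally show ?thesis .
qed

lemma select_cols_mult_mat_diag:
  assumes "A \<in> carrier_mat r m" and "set ks \<subseteq> {..<m}"
  shows "select_cols (A * mat_diag m w) ks =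
    select_cols A ks * mat_diag (length ks) (\<lambda>j. w (ks ! j))"
  unfolding mat_diag_mult_right[OF assms(1)]
    mat_diag_mult_right[OF select_cols_carrier[OF assms(1)]]
  using assms nth_mem[of _ ks]
  by (intro eq_matI) (auto simp: select_cols_def subset_iff)

corollary Cauchy_Binet_mat_diag:
  fixes A B :: "'a::comm_ring_1 mat"
  assumes A: "A \<in> carrier_mat r m" and B: "B \<in> carrier_mat r m"
  shows "det (A * mat_diag m w * B\<^sup>T) = (\<Sum>ks \<in> increasing_tuples r m.
    det (select_cols A ks) * det (select_cols B ks) * (\<Prod>k\<leftarrow>ks. w k))"
proof -
  have "det (select_cols (A * mat_diag m w) ks) = det (select_cols A ks) * (\<Prod>k\<leftarrow>ks. w k)"
    if "ks \<in> increasing_tuples r m" for ks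
  proof -
    from that have ks: "length ks = r" "set ks \<subseteq> {..<m}"
      by (auto simp: increasing_tuples_def)
    have "select_cols A ks \<in> carrier_mat r r"
      using select_cols_carrier[OF A, of ks] ks(1) by simp
    then have "det (select_cols (A * mat_diag m w) ks) =
        det (select_cols A ks) * (\<Prod>j<r. w (ks ! j))"
      using ks by (simp add: select_cols_mult_mat_diag[OF A] det_mult[of _ r] det_mat_diag)
    then show ?thesis
      using ks(1) by (simp add: prod.list_conv_set_nth atLeast0LessThan)
  qed
  moreover have "A * mat_diag m w \<in> carrier_mat r m"
    using A by (rule mult_carrier_mat) simp
  ultimately show ?thesis
    using Cauchy_Binet[OF _ B] by (simp add: mult_ac)
qed

section \<open>Determinants and minors of join matrices\<close>

lemma sum_Psi_above:
  fixes d :: "'a::order"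
  assumes "finite D" "d \<in> D"
  shows "(\<Sum>v | v \<in> D \<and> d \<le> v. Psi D f v) = f d"
proof -
  have "{v \<in> D. d \<le> v} = insert d {v \<in> D. d < v}"
    using assms by (auto simp: le_less)
  then show ?thesis
    using assms by (simp add: Psi.simps[of D f d])
qed

lemma incidence_mat_carrier [simp]:
  "incidence_mat ds zs \<in> carrier_mat (length zs) (length ds)"
  by (simp add: incidence_mat_def)

lemma join_mat_carrier [simp]: "join_mat f xs ys \<in> carrier_mat (length xs) (length ys)"
  by (simp add: join_mat_def)

lemma join_mat_eq_incidence_mat_mult:
  fixes f :: "'a::lattice \<Rightarrow> complex"
  assumes ds: "distinct ds"
    and sup: "\<And>x y. x \<in> set xs \<Longrightarrow> y \<in> set ys \<Longrightarrow> sup x y \<in> set ds"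
  shows "join_mat f xs ys = incidence_mat ds xs *
    mat_diag (length ds) (\<lambda>k. Psi (set ds) f (ds ! k)) * (incidence_mat ds ys)\<^sup>T"
  (is "_ = ?R")
proof (rule eq_matI)
  fix i j
  assume "i < dim_row ?R" and "j < dim_col ?R"
  then have i: "i < length xs" and j: "j < length ys"
    by (simp_all add: incidence_mat_def)
  let ?s = "sup (xs ! i) (ys ! j)"
  have "f ?s = (\<Sum>v | v \<in> set ds \<and> ?s \<le> v. Psi (set ds) f v)"
    using sum_Psi_above[of "set ds" ?s f] sup i j by simp
  also have "\<dots> = (\<Sum>v\<in>set ds. if ?s \<le> v then Psi (set ds) f v else 0)"
    by (simp add: sum.inter_filter)
  also have "\<dots> = (\<Sum>k<length ds. if ?s \<le> ds ! k then Psi (set ds) f (ds ! k) else 0)"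
    by (rule sum.reindex_bij_betw[OF bij_betw_nth[OF ds refl refl], symmetric])
  also have "\<dots> = ?R $$ (i, j)"
    unfolding mat_diag_mult_right[OF incidence_mat_carrier]
    using i j by (auto simp: incidence_mat_def scalar_prod_def atLeast0LessThan intro!: sum.cong)
  finally show "join_mat f xs ys $$ (i, j) = ?R $$ (i, j)"
    using i j by (simp add: join_mat_def)
qed (simp_all add: join_mat_def incidence_mat_def)

corollary det_join_mat:
  fixes f :: "'a::lattice \<Rightarrow> complex"
  assumes len: "length ys = length xs" and ds: "distinct ds"
    and sup: "\<And>x y. x \<in> set xs \<Longrightarrow> y \<in> set ys \<Longrightarrow> sup x y \<in> set ds"
  shows "det (join_mat f xs ys) = (\<Sum>ks \<in> increasing_tuples (length xs) (length ds).
    det (select_cols (incidence_mat ds xs) ks) * det (select_cols (incidence_mat ds ys) ks) *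
    (\<Prod>k\<leftarrow>ks. Psi (set ds) f (ds ! k)))"
  using len sup incidence_mat_carrier[of ds ys]
  by (simp add: join_mat_eq_incidence_mat_mult[OF ds]
      Cauchy_Binet_mat_diag[OF incidence_mat_carrier])

lemma removeAll_nth_conv_take_drop:
  assumes "distinct xs" "j < length xs"
  shows "removeAll (xs ! j) xs = take j xs @ drop (Suc j) xs"
  using assms
proof (induction xs arbitrary: j)
  case (Cons x xs)
  then show ?case by (cases j) auto
qed simp

lemma mat_delete_join_mat:
  assumes "distinct xs" "i < length xs" "distinct ys" "j < length ys"
  shows "mat_delete (join_mat f xs ys) i j =
    join_mat f (removeAll (xs ! i) xs) (removeAll (ys ! j) ys)"
  using assms
  by (intro eq_matI)
    (auto simp: join_mat_def mat_delete_def removeAll_nth_conv_take_drop nth_append min_def)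

corollary cofactor_join_mat:
  fixes f :: "'a::lattice \<Rightarrow> complex"
  assumes "length ys = length xs" "distinct xs" "distinct ys" "distinct ds"
    and "\<And>x y. x \<in> set xs \<Longrightarrow> y \<in> set ys \<Longrightarrow> sup x y \<in> set ds"
    and "i < length xs" "j < length xs"
  shows "cofactor (join_mat f xs ys) i j = (- 1) ^ (i + j) *
    (\<Sum>ks \<in> increasing_tuples (length xs - 1) (length ds).
      det (select_cols (incidence_mat ds (removeAll (xs ! i) xs)) ks) *
      det (select_cols (incidence_mat ds (removeAll (ys ! j) ys)) ks) *
      (\<Prod>k\<leftarrow>ks. Psi (set ds) f (ds ! k)))"
proof -
  have "length (removeAll (xs ! i) xs) = length xs - 1"
    and "length (removeAll (ys ! j) ys) = length xs - 1"
    using assms by (simp_all add: removeAll_nth_conv_take_drop)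
  then show ?thesis
    using assms det_join_mat[of "removeAll (ys ! j) ys" "removeAll (xs ! i) xs" ds f]
    by (simp add: cofactor_def mat_delete_join_mat)
qed

section \<open>The inverse of a join matrix\<close>

lemma invertible_mat_det_dvd_1:
  fixes A :: "'a::comm_ring_1 mat"
  assumes "invertible_mat A"
  shows "det A dvd 1"
proof -
  let ?n = "dim_row A"
  from assms obtain C where square: "dim_row A = dim_col A"
    and AC: "A * C = 1\<^sub>m ?n" and CA: "C * A = 1\<^sub>m (dim_row C)"
    by (auto simp: invertible_mat_def inverts_mat_def)
  have A: "A \<in> carrier_mat ?n ?n"
    using square by (intro carrier_matI) simp_all
  have "C \<in> carrier_mat ?n ?n"
    using arg_cong[OF AC, of dim_col] arg_cong[OF CA, of dim_col] square
    by (intro carrier_matI) simp_all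
  then have "det A * det C = 1"
    using det_mult[OF A] AC by (metis det_one)
  then show ?thesis by (metis dvd_triv_left)
qed

lemma inverts_mat_smult_adj_mat:
  fixes A :: "'a::field mat"
  assumes A: "A \<in> carrier_mat n n" and det: "det A \<noteq> 0"
  shows "inverts_mat A ((1 / det A) \<cdot>\<^sub>m adj_mat A)"
    and "inverts_mat ((1 / det A) \<cdot>\<^sub>m adj_mat A) A"
proof -
  have unit: "(1 / det A) \<cdot>\<^sub>m (det A \<cdot>\<^sub>m 1\<^sub>m n) = 1\<^sub>m n"
    using det by (intro eq_matI) auto
  show "inverts_mat A ((1 / det A) \<cdot>\<^sub>m adj_mat A)"
    using A unit mult_smult_distrib[OF A adj_mat(1)[OF A]] adj_mat(2)[OF A]
    by (simp add: inverts_mat_def)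
  show "inverts_mat ((1 / det A) \<cdot>\<^sub>m adj_mat A) A"
    using A unit mult_smult_assoc_mat[OF adj_mat(1)[OF A] A] adj_mat(1,3)[OF A]
    by (simp add: inverts_mat_def)
qed

theorem theorem5p1:
  fixes f :: "'a::lattice \<Rightarrow> complex"
    and xs ys ds :: "'a list"
    and n m :: nat
    and B :: "complex mat"
  assumes locally_finite: "\<And>a b :: 'a. finite {a..b}"
    and "length xs = n" and "order_indexed xs"
    and "length ys = n" and "order_indexed ys"
    and "length ds = m" and "order_indexed ds"
    and "\<And>x y. x \<in> set xs \<Longrightarrow> y \<in> set ys \<Longrightarrow> sup x y \<in> set ds"
    and "invertible_mat (join_mat f xs ys)"
    and "B = mat n n (\<lambda>(i, j).
          (- 1) ^ (i + j) / det (join_mat f xs ys) *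
          (\<Sum>ks \<in> increasing_tuples (n - 1) m.
             det (select_cols (incidence_mat ds (removeAll (xs ! j) xs)) ks) *
             det (select_cols (incidence_mat ds (removeAll (ys ! i) ys)) ks) *
             (\<Prod>k\<leftarrow>ks. Psi (set ds) f (ds ! k))))"
  shows "inverts_mat (join_mat f xs ys) B \<and> inverts_mat B (join_mat f xs ys)"
proof -
  let ?A = "join_mat f xs ys"
  have distinct: "distinct xs" "distinct ys" "distinct ds"
    using assms by (simp_all add: order_indexed_def)
  have A: "?A \<in> carrier_mat n n"
    using assms join_mat_carrier[of f xs ys] by simp
  have "B = (1 / det ?A) \<cdot>\<^sub>m adj_mat ?A"
  proof (rule eq_matI)
    fix i j
    assume "i < dim_row ((1 / det ?A) \<cdot>\<^sub>m adj_mat ?A)" "j < dim_col ((1 / det ?A) \<cdot>\<^sub>m adj_mat ?A)"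
    then show "B $$ (i, j) = ((1 / det ?A) \<cdot>\<^sub>m adj_mat ?A) $$ (i, j)"
      using A assms distinct by (simp add: adj_mat_def cofactor_join_mat add.commute)
  qed (use A assms in \<open>simp_all add: adj_mat_def\<close>)
  moreover have "det ?A \<noteq> 0"
    using invertible_mat_det_dvd_1[OF assms(9)] by auto
  ultimately show ?thesis
    using inverts_mat_smult_adj_mat[OF A] by simp
qed

end
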